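(* If $G_1$ is a Type 1 graph on $n$ vertices (i.e. $\chi''(G_1)=\Delta(G_1)+1$) and $G_2$ is any graph on $n$ vertices such that $\Delta(G_1)\ge\Delta(G_2)$, then $G_1\vee G_2$ satisfies the AVD-TCC, i.e. $\chi''_a(G_1\vee G_2)\le\Delta(G_1\vee G_2)+3$.
   Context: All graphs are finite, undirected and simple. $\Delta(G)$ is the maximum degree of $G$. A proper total coloring of $G$ is a coloring of $V(G)\cup E(G)$ in which no two adjacent or incident elements receive the same color. The total chromatic number $\chi''(G)$ is the least number of colors in a proper total coloring of $G$; $G$ is of Type 1 if $\chi''(G)=\Delta(G)+1$. An adjacent vertex distinguishing (AVD) total coloring of $G$ is a proper total coloring $f$ such that $C_G(u)\ne C_G(v)$ for every edge $uv\in E(G)$, where $C_G(u)=\{f(u)\}\cup\{f(uw): uw\in E(G)\}$. The AVD-total chromatic number $\chi''_a(G)$ is the least number of colors in an AVD-total coloring of $G$. The join $G_1\vee G_2$ is obtained from the disjoint union of $G_1$ and $G_2$ by adding all edges between a vertex of $G_1$ and a vertex of $G_2$. *)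

theory Defs
  imports Main
begin

record 'a graph =
  verts :: "'a set"
  edges :: "'a set set"

definition simple_graph :: "'a graph \<Rightarrow> bool" where
  "simple_graph G \<longleftrightarrow> finite (verts G) \<and> (\<forall>e\<in>edges G. e \<subseteq> verts G \<and> card e = 2)"

definition degree :: "'a graph \<Rightarrow> 'a \<Rightarrow> nat" where
  "degree G v = card {e \<in> edges G. v \<in> e}"

text \<open>
  Inserting 0 changes the value only for the graph without vertices, whose maximum degree
  is thereby 0. That graph has total chromatic number 0, so it is not of Type 1.
\<close>

definition max_degree :: "'a graph \<Rightarrow> nat" where
  "max_degree G = Max (insert 0 (degree G ` verts G))"

definition join :: "'a graph \<Rightarrow> 'b graph \<Rightarrow> ('a + 'b) graph" where
  "join G H =
     \<lparr>verts = verts G <+> verts H,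
      edges = (image Inl) ` edges G \<union> (image Inr) ` edges H
                \<union> {{Inl u, Inr v} |u v. u \<in> verts G \<and> v \<in> verts H}\<rparr>"

text \<open>
  A total coloring is a function on the disjoint union of vertices (\<open>Inl\<close>) and edges
  (\<open>Inr\<close>); only its values on \<open>verts G <+> edges G\<close> matter.
\<close>

definition proper_total_coloring :: "'a graph \<Rightarrow> ('a + 'a set \<Rightarrow> 'c) \<Rightarrow> bool" where
  "proper_total_coloring G f \<longleftrightarrow>
     (\<forall>u v. {u, v} \<in> edges G \<longrightarrow> f (Inl u) \<noteq> f (Inl v)) \<and>
     (\<forall>e\<in>edges G. \<forall>e'\<in>edges G. e \<noteq> e' \<and> e \<inter> e' \<noteq> {} \<longrightarrow> f (Inr e) \<noteq> f (Inr e')) \<and>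
     (\<forall>e\<in>edges G. \<forall>v\<in>e. f (Inl v) \<noteq> f (Inr e))"

definition color_set :: "'a graph \<Rightarrow> ('a + 'a set \<Rightarrow> 'c) \<Rightarrow> 'a \<Rightarrow> 'c set" where
  "color_set G f u = {f (Inl u)} \<union> {f (Inr {u, w}) |w. {u, w} \<in> edges G}"

definition avd_total_coloring :: "'a graph \<Rightarrow> ('a + 'a set \<Rightarrow> 'c) \<Rightarrow> bool" where
  "avd_total_coloring G f \<longleftrightarrow>
     proper_total_coloring G f \<and>
     (\<forall>u v. {u, v} \<in> edges G \<longrightarrow> color_set G f u \<noteq> color_set G f v)"

text \<open>
  Both minima below are over nonempty sets for finite simple graphs, since a coloring giving
  all vertices and edges different colors is an AVD-total coloring.
\<close>

definition total_chromatic_number :: "'a graph \<Rightarrow> nat" where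
  "total_chromatic_number G =
     (LEAST k. \<exists>f :: 'a + 'a set \<Rightarrow> nat.
        proper_total_coloring G f \<and> f ` (verts G <+> edges G) \<subseteq> {..<k})"

definition avd_total_chromatic_number :: "'a graph \<Rightarrow> nat" where
  "avd_total_chromatic_number G =
     (LEAST k. \<exists>f :: 'a + 'a set \<Rightarrow> nat.
        avd_total_coloring G f \<and> f ` (verts G <+> edges G) \<subseteq> {..<k})"

definition type_1 :: "'a graph \<Rightarrow> bool" where
  "type_1 G \<longleftrightarrow> total_chromatic_number G = max_degree G + 1"

definition satisfies_avd_tcc :: "'a graph \<Rightarrow> bool" where
  "satisfies_avd_tcc G \<longleftrightarrow> avd_total_chromatic_number G \<le> max_degree G + 3"

end

theory Submission
  imports Defs
begin

text \<open>
  A total coloring of \<open>G1\<close> with \<open>D = \<Delta>(G1) + 1\<close> colors exists because \<open>G1\<close> is of Type 1, and by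
  Vizing's theorem the same \<open>D\<close> colors suffice for the edges of \<open>G2\<close>. Take \<open>n + 2\<close> further colors,
  identified with the residues modulo \<open>n + 2\<close>; the edge from the \<open>i\<close>-th vertex of \<open>G1\<close> to the \<open>j\<close>-th
  vertex of \<open>G2\<close> gets \<open>i + j\<close> and the \<open>j\<close>-th vertex of \<open>G2\<close> itself gets \<open>n + j\<close>. Among the further colors
  the \<open>i\<close>-th vertex of \<open>G1\<close> misses exactly \<open>i + n\<close> and \<open>i + n + 1\<close> and the \<open>j\<close>-th vertex of \<open>G2\<close> misses
  exactly \<open>j + n + 1\<close>, so all color sets are distinct.
\<close>

section \<open>Vizing's theorem\<close>

text \<open>
  Applied to the partner maps of two color classes, so that \<open>C\<close> is a Kempe component: besides the
  end \<open>x\<close> it has at most one other end.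
\<close>

lemma alternating_orbit:
  assumes \<sigma>: "\<And>v. \<sigma> (\<sigma> v) = v" and \<tau>: "\<And>v. \<tau> (\<tau> v) = v" and x: "\<sigma> x = x"
  obtains C where "x \<in> C" "\<And>v. v \<in> C \<Longrightarrow> \<sigma> v \<in> C" "\<And>v. v \<in> C \<Longrightarrow> \<tau> v \<in> C"
    "\<And>y z. \<lbrakk>y \<in> C; z \<in> C; y \<noteq> x; z \<noteq> x; \<sigma> y = y \<or> \<tau> y = y; \<sigma> z = z \<or> \<tau> z = z\<rbrakk> \<Longrightarrow> y = z"
proof -
  \<comment> \<open>The walk from \<open>x\<close> that applies \<tau> and \<sigma> in turn; \<tau>
    comes first because \<sigma> fixes \<open>x\<close>.\<close>
  define w where "w = rec_nat x (\<lambda>m v. if even m then \<tau> v else \<sigma> v)"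
  have w0: "w 0 = x" and wS: "\<And>m. w (Suc m) = (if even m then \<tau> (w m) else \<sigma> (w m))"
    by (simp_all add: w_def)
  \<comment> \<open>At \<open>i = 0\<close> truncated subtraction makes \<open>w (i - 1)\<close>
    equal to \<open>x\<close>, the value of \<sigma> there.\<close>
  have neighbours: "\<sigma> (w i) \<in> {w (i - 1), w (Suc i)} \<and> \<tau> (w i) \<in> {w (i - 1), w (Suc i)}" for i
    by (cases i) (auto simp: w0 wS \<sigma> \<tau> x)
  \<comment> \<open>If the walk stalls at \<open>m\<close>, the points seen so far are closed under
    both maps: the neighbours of each of them, including the last, are among them.\<close>
  have cut: "w i \<in> w ` {..m}" if "w (Suc m) = w m" for m i
  proof (induction i)
    case (Suc i)
    then obtain j where j: "j \<le> m" "w i = w j" by auto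
    have "j - 1 \<le> m" using j by simp
    moreover have "w (Suc j) \<in> w ` {..m}"
      using j that by (cases "j = m") (auto intro!: imageI simp: Suc_le_eq)
    ultimately have "w (j - 1) \<in> w ` {..m}" "w (Suc j) \<in> w ` {..m}" by auto
    with neighbours[of j] have "\<sigma> (w j) \<in> w ` {..m}" "\<tau> (w j) \<in> w ` {..m}"
      by (metis insertE singletonD)+
    then show ?case by (simp add: wS j(2))
  qed simp
  \<comment> \<open>The map that led to \<open>w m\<close> moves it, since it takes it back to the
    different point \<open>w l\<close>. So the map fixing \<open>w m\<close> is the one applied
    next.\<close>
  have stop: "w (Suc m) = w m"
    if "w m \<noteq> x" "\<sigma> (w m) = w m \<or> \<tau> (w m) = w m" "\<And>i. i < m \<Longrightarrow> w i \<noteq> w m" for m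
  proof (cases m)
    case (Suc l)
    have "w l \<noteq> w m" using that(3) Suc by simp
    with that(2) show ?thesis unfolding Suc by (auto simp: wS \<sigma> \<tau> split: if_splits)
  qed (use that w0 in auto)
  have first: "\<exists>m. w m = y \<and> (\<forall>i<m. w i \<noteq> y)" if "y \<in> range w" for y
  proof -
    from that obtain m where "w m = y" by auto
    then show ?thesis using LeastI[of "\<lambda>m. w m = y"] not_less_Least by blast
  qed
  show thesis
  proof (rule that[of "range w"])
    show "x \<in> range w" using w0 by (metis rangeI)
    show "\<sigma> v \<in> range w" "\<tau> v \<in> range w" if "v \<in> range w" for v
      using that neighbours by blast+
    fix y z
    assume yz: "y \<in> range w" "z \<in> range w" "y \<noteq> x" "z \<noteq> x"
      "\<sigma> y = y \<or> \<tau> y = y" "\<sigma> z = z \<or> \<tau> z = z"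
    obtain m where m: "w m = y" "\<forall>i<m. w i \<noteq> y" using first yz by blast
    obtain l where l: "w l = z" "\<forall>i<l. w i \<noteq> z" using first yz by blast
    have "w (Suc m) = w m" "w (Suc l) = w l" using stop m l yz by auto
    \<comment> \<open>Both first visits end the walk, so each of \<open>m\<close> and
      \<open>l\<close> bounds the other.\<close>
    then have "w l \<in> w ` {..m}" "w m \<in> w ` {..l}" using cut by blast+
    then have "l \<le> m" "m \<le> l" using m l by (metis atMost_iff image_iff le_less_trans not_le)+
    then show "y = z" using m l by simp
  qed
qed

section \<open>Edge colorings, free colors and Vizing fans\<close>

definition proper_edge_coloring :: "'a set set \<Rightarrow> ('a set \<Rightarrow> nat) \<Rightarrow> nat \<Rightarrow> bool" where
  "proper_edge_coloring F c k \<longleftrightarrow> (\<forall>e\<in>F. c e < k) \<and>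
     (\<forall>e\<in>F. \<forall>e'\<in>F. e \<noteq> e' \<and> e \<inter> e' \<noteq> {} \<longrightarrow> c e \<noteq> c e')"

text \<open>The edge set is an argument, so that a partial coloring of a graph is treated as a
  coloring of the smaller set \<open>F\<close>.\<close>

definition free_colors :: "'a set set \<Rightarrow> ('a set \<Rightarrow> nat) \<Rightarrow> nat \<Rightarrow> 'a \<Rightarrow> nat set" where
  "free_colors F c k v = {a. a < k \<and> (\<forall>e\<in>F. v \<in> e \<longrightarrow> c e \<noteq> a)}"

lemma proper_edge_coloringD:
  assumes "proper_edge_coloring F c k" "e \<in> F" "e' \<in> F" "v \<in> e" "v \<in> e'" "c e = c e'"
  shows "e = e'"
  using assms unfolding proper_edge_coloring_def by blast

lemma free_colors_nonempty:
  assumes "finite F" "card {e\<in>F. v \<in> e} < k"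
  shows "free_colors F c k v \<noteq> {}"
proof
  assume "free_colors F c k v = {}"
  then have "{..<k} \<subseteq> c ` {e\<in>F. v \<in> e}" unfolding free_colors_def by auto
  then have "card {..<k} \<le> card (c ` {e\<in>F. v \<in> e})" using assms(1) by (intro card_mono) auto
  also have "\<dots> \<le> card {e\<in>F. v \<in> e}" using assms(1) by (intro card_image_le) auto
  finally show False using assms(2) by simp
qed

lemma proper_edge_coloring_insert:
  assumes "proper_edge_coloring F c k" "a \<in> free_colors F c k x" "a \<in> free_colors F c k y"
  shows "proper_edge_coloring (insert {x, y} F) (c({x, y} := a)) k"
  using assms unfolding proper_edge_coloring_def free_colors_def
  by (auto simp del: insert_iff simp add: insert_iff[of _ "{x,y}" F])

text \<open>A Vizing fan at \<open>x\<close>. Nothing is asked of the edge from \<open>x\<close> to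
  the first vertex, which is the edge still to be colored.\<close>

abbreviation fan :: "'a set set \<Rightarrow> ('a set \<Rightarrow> nat) \<Rightarrow> nat \<Rightarrow> 'a \<Rightarrow> 'a list \<Rightarrow> bool" where
  "fan F c k x ys \<equiv> successively (\<lambda>y z. {x, z} \<in> F \<and> c {x, z} \<in> free_colors F c k y) ys"

text \<open>The colors are shifted toward the front: each edge of the fan takes over the color of
  the next one and the last takes \<open>a\<close>. The induction does one shift at a time, with
  \<open>{x, z}\<close> becoming the uncolored edge.\<close>

lemma fan_extend_coloring:
  assumes "proper_edge_coloring F c k" "{x, y} \<notin> F" "distinct (x # y # ys)" "fan F c k x (y # ys)"
    "a \<in> free_colors F c k x" "a \<in> free_colors F c k (last (y # ys))"
  shows "\<exists>c'. proper_edge_coloring (insert {x, y} F) c' k"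
  using assms
proof (induction ys arbitrary: F c y)
  case Nil
  then show ?case using proper_edge_coloring_insert by fastforce
next
  case (Cons z ys)
  define b where "b = c {x, z}"
  define F' where "F' = insert {x, y} (F - {{x, z}})"
  define c' where "c' = c({x, y} := b)"
  have xz: "{x, z} \<in> F" and b_y: "b \<in> free_colors F c k y" using Cons.prems(4) by (auto simp: b_def)
  have neq: "{x, y} \<noteq> {x, z}" using Cons.prems(3) by (auto simp: doubleton_eq_iff)
  \<comment> \<open>Once uncolored, \<open>{x, z}\<close> releases its color \<open>b\<close> at
    \<open>x\<close>.\<close>
  have bx: "b \<in> free_colors (F - {{x, z}}) c k x"
    using Cons.prems(1) xz proper_edge_coloringD[OF Cons.prems(1) _ xz, of _ x]
    unfolding b_def free_colors_def proper_edge_coloring_def by auto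
  have "proper_edge_coloring (F - {{x, z}}) c k"
    using Cons.prems(1) unfolding proper_edge_coloring_def by auto
  moreover have "b \<in> free_colors (F - {{x, z}}) c k y"
    using b_y unfolding free_colors_def by auto
  ultimately have pc: "proper_edge_coloring F' c' k"
    unfolding F'_def c'_def using bx by (intro proper_edge_coloring_insert)
  \<comment> \<open>Only \<open>y\<close> can lose a free color; at \<open>x\<close> the color
    \<open>b\<close> merely moves to another edge.\<close>
  have free: "free_colors F c k v \<subseteq> free_colors F' c' k v" if "v \<noteq> y" for v
    using that xz Cons.prems(2) unfolding free_colors_def F'_def c'_def b_def by auto
  have fan': "fan F' c' k x (z # ys)"
    unfolding successively_conv_nth
  proof (intro allI impI)
    fix i assume i: "Suc i < length (z # ys)"
    let ?u = "(z # ys) ! i" and ?v = "(z # ys) ! Suc i"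
    have "{x, ?v} \<in> F" "c {x, ?v} \<in> free_colors F c k ?u"
      using Cons.prems(4) i by (auto simp: successively_conv_nth)
    moreover have "?u \<in> set (z # ys)" "?v \<in> set ys" using i nth_mem[of i "z # ys"] by auto
    then have "?u \<noteq> y" "{x, ?v} \<noteq> {x, y}" "{x, ?v} \<noteq> {x, z}"
      using Cons.prems(3) by (auto simp: doubleton_eq_iff)
    ultimately show "{x, ?v} \<in> F' \<and> c' {x, ?v} \<in> free_colors F' c' k ?u"
      using free unfolding F'_def c'_def by auto
  qed
  have "free_colors F c k x = free_colors F' c' k x"
    using neq xz Cons.prems(2) unfolding free_colors_def F'_def c'_def b_def by auto
  then have "a \<in> free_colors F' c' k x" using Cons.prems(5) by simp
  moreover have "last (z # ys) \<noteq> y" using Cons.prems(3) last_in_set[of "z # ys"] by auto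
  then have "a \<in> free_colors F' c' k (last (z # ys))"
    using subsetD[OF free] Cons.prems(6) by (metis last_ConsR list.distinct(1))
  moreover have "{x, z} \<notin> F'" "distinct (x # z # ys)" using neq Cons.prems(3) by (auto simp: F'_def)
  ultimately have "\<exists>c''. proper_edge_coloring (insert {x, z} F') c'' k"
    by (intro Cons.IH[OF pc _ _ fan'])
  moreover have "insert {x, z} F' = insert {x, y} F" using xz by (auto simp: F'_def)
  ultimately show ?case by simp
qed

text \<open>Exchanges \<open>a\<close> and \<open>b\<close> on the Kempe component \<open>C\<close>
  of \<open>x\<close>. As \<open>a\<close> is free at \<open>x\<close>, the component is a path that
  starts there, which leaves room for at most one other vertex missing \<open>b\<close>.\<close>

lemma kempe_swap:
  assumes F: "proper_edge_coloring F c k" "\<forall>e\<in>F. card e = 2"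
    and ab: "a \<in> free_colors F c k x" "b < k"
  defines "swap \<equiv> id(a := b, b := a)"
  obtains C c' where "proper_edge_coloring F c' k" "x \<in> C"
    "\<And>e. \<lbrakk>e \<in> F; e \<inter> C \<noteq> {}\<rbrakk> \<Longrightarrow> c' e = swap (c e)"
    "\<And>v d. v \<in> C \<Longrightarrow> d \<in> free_colors F c' k v \<longleftrightarrow> swap d \<in> free_colors F c k v"
    "\<And>v. v \<notin> C \<Longrightarrow> free_colors F c' k v = free_colors F c k v"
    "\<And>y z. \<lbrakk>y \<in> C; z \<in> C; y \<noteq> x; z \<noteq> x; b \<in> free_colors F c k y; b \<in> free_colors F c k z\<rbrakk> \<Longrightarrow> y = z"
proof -
  \<comment> \<open>The other end of the edge of color \<open>d\<close> at \<open>v\<close>. The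
    default \<open>v\<close>, when there is no such edge, makes \<open>mate d\<close> an involution
    that fixes the vertices where \<open>d\<close> is free.\<close>
  define mate where "mate d v = (if \<exists>w. {v, w} \<in> F \<and> c {v, w} = d
    then SOME w. {v, w} \<in> F \<and> c {v, w} = d else v)" for d v
  have mate: "mate d v = w" if "{v, w} \<in> F" "c {v, w} = d" for d v w
  proof -
    have "w' = w" if w': "{v, w'} \<in> F" "c {v, w'} = d" for w'
    proof -
      have "{v, w'} = {v, w}"
        using proper_edge_coloringD[OF F(1) w'(1) \<open>{v, w} \<in> F\<close>, of v] w'(2) \<open>c {v, w} = d\<close>
        by simp
      then show ?thesis by (auto simp: doubleton_eq_iff)
    qed
    with that have "(SOME w. {v, w} \<in> F \<and> c {v, w} = d) = w" by (intro some_equality) blast+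
    with that show ?thesis unfolding mate_def by metis
  qed
  have mate_free: "mate d v = v" if "d \<in> free_colors F c k v" for d v
    using that unfolding mate_def free_colors_def by auto
  have invol: "mate d (mate d v) = v" for d v
  proof (cases "\<exists>w. {v, w} \<in> F \<and> c {v, w} = d")
    case True
    then obtain w where w: "{v, w} \<in> F" "c {v, w} = d" by auto
    then have "{w, v} \<in> F" "c {w, v} = d" by (auto simp: insert_commute)
    then show ?thesis using w mate by metis
  qed (auto simp: mate_def)
  obtain C where C: "x \<in> C" "\<And>v. v \<in> C \<Longrightarrow> mate a v \<in> C" "\<And>v. v \<in> C \<Longrightarrow> mate b v \<in> C"
    "\<And>y z. \<lbrakk>y \<in> C; z \<in> C; y \<noteq> x; z \<noteq> x; mate a y = y \<or> mate b y = y; mate a z = z \<or> mate b z = z\<rbrakk> \<Longrightarrow> y = z"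
    by (rule alternating_orbit[of "mate a" "mate b" x, OF invol invol mate_free[OF ab(1)]]) blast
  have closed: "e \<subseteq> C" if e: "e \<in> F" "e \<inter> C \<noteq> {}" "c e \<in> {a, b}" for e
  proof -
    obtain v where "v \<in> e" "v \<in> C" using e by auto
    moreover from F(2) e(1) obtain p q where "e = {p, q}" by (auto simp: card_2_iff)
    ultimately obtain w where w: "e = {v, w}" "v \<in> C" by (auto simp: insert_commute)
    then have "w = mate a v \<or> w = mate b v" using mate e by auto
    then show ?thesis using w C by auto
  qed
  \<comment> \<open>Edges of \<open>F\<close> leaving \<open>C\<close> also fall under the first
    case, but by \<open>closed\<close> their colors are neither \<open>a\<close> nor
    \<open>b\<close>, so the swap leaves them alone.\<close>
  define c' where "c' e = (if e \<inter> C \<noteq> {} then swap (c e) else c e)" for e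
  have swap: "swap (swap d) = d" "swap d < k \<longleftrightarrow> d < k" "swap d = swap d' \<longleftrightarrow> d = d'" for d d'
    using ab by (auto simp: swap_def free_colors_def)
  have fixed: "c' e = c e" if "e \<in> F" "\<not> e \<subseteq> C" for e
    using closed[of e] that by (auto simp: c'_def swap_def)
  show thesis
  proof (rule that[of c' C])
    show "proper_edge_coloring F c' k"
      unfolding proper_edge_coloring_def
    proof (intro conjI ballI impI)
      show "c' e < k" if "e \<in> F" for e
        using that F(1) by (auto simp: c'_def swap proper_edge_coloring_def)
      fix e e' assume e: "e \<in> F" "e' \<in> F" "e \<noteq> e' \<and> e \<inter> e' \<noteq> {}"
      then obtain v where v: "v \<in> e" "v \<in> e'" by auto
      have "c e \<noteq> c e'" using F(1) e by (auto simp: proper_edge_coloring_def)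
      \<comment> \<open>Both edges contain \<open>v\<close>, so whether \<open>v\<close> lies in
        \<open>C\<close> decides whether both colors are swapped or both kept.\<close>
      moreover have "c' e = swap (c e) \<and> c' e' = swap (c e')" if "v \<in> C"
        using that v by (auto simp: c'_def)
      moreover have "c' e = c e \<and> c' e' = c e'" if "v \<notin> C"
        using that v e fixed by auto
      ultimately show "c' e \<noteq> c' e'" using swap by metis
    qed
    show "c' e = swap (c e)" if "e \<in> F" "e \<inter> C \<noteq> {}" for e
      using that by (simp add: c'_def)
    show "d \<in> free_colors F c' k v \<longleftrightarrow> swap d \<in> free_colors F c k v" if "v \<in> C" for v d
    proof -
      have "c' e = swap (c e)" if "v \<in> e" for e using that \<open>v \<in> C\<close> by (auto simp: c'_def)
      then show ?thesis unfolding free_colors_def using swap by simp metis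
    qed
    show "free_colors F c' k v = free_colors F c k v" if "v \<notin> C" for v
    proof -
      have "c' e = c e" if "e \<in> F" "v \<in> e" for e using that \<open>v \<notin> C\<close> fixed by auto
      then show ?thesis unfolding free_colors_def by auto
    qed
  qed (use C mate_free in auto)
qed

text \<open>
  The ends \<open>x\<close>, \<open>u\<close> and \<open>last (z # qs)\<close> cannot all lie in one \<open>a\<close>/\<open>b\<close>-component. Swapping the component
  of \<open>x\<close> frees \<open>b\<close> at \<open>x\<close>; then the fan up to \<open>u\<close>, or else the whole fan, can be shifted.
\<close>

lemma fan_cycle_extend_coloring:
  assumes F: "proper_edge_coloring F c k" "\<forall>e\<in>F. card e = 2"
    and xy: "{x, hd (ps @ [u])} \<notin> F" and dist: "distinct (x # ps @ u # z # qs)"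
    and fan: "fan F c k x (ps @ u # z # qs)"
    and a: "a \<in> free_colors F c k x" and b: "b \<in> free_colors F c k (last (z # qs))"
    and bz: "c {x, z} = b"
  shows "\<exists>c'. proper_edge_coloring (insert {x, hd (ps @ [u])} F) c' k"
proof -
  let ?l = "last (z # qs)" and ?swap = "id(a := b, b := a)"
  have bk: "b < k" using b by (auto simp: free_colors_def)
  have xz: "{x, z} \<in> F" and bu: "b \<in> free_colors F c k u"
    using fan bz by (auto simp: successively_append_iff)
  have ab: "a \<noteq> b" using a xz bz by (auto simp: free_colors_def)
  obtain C c' where C: "proper_edge_coloring F c' k" "x \<in> C"
    "\<And>e. \<lbrakk>e \<in> F; e \<inter> C \<noteq> {}\<rbrakk> \<Longrightarrow> c' e = ?swap (c e)"
    "\<And>v d. v \<in> C \<Longrightarrow> d \<in> free_colors F c' k v \<longleftrightarrow> ?swap d \<in> free_colors F c k v"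
    "\<And>v. v \<notin> C \<Longrightarrow> free_colors F c' k v = free_colors F c k v"
    "\<And>y z. \<lbrakk>y \<in> C; z \<in> C; y \<noteq> x; z \<noteq> x; b \<in> free_colors F c k y; b \<in> free_colors F c k z\<rbrakk> \<Longrightarrow> y = z"
    by (rule kempe_swap[OF F a bk]) (rule that; assumption)
  have bx: "b \<in> free_colors F c' k x" using C(2,4) a by simp
  \<comment> \<open>An edge \<open>{x, w}\<close> other than \<open>{x, z}\<close> carries neither
    \<open>a\<close>, free at \<open>x\<close>, nor \<open>b\<close>, used at \<open>x\<close> by
    \<open>{x, z}\<close>. The swap therefore changes neither its color nor whether that color is
    free at a vertex.\<close>
  have step: "{x, w} \<in> F \<and> c' {x, w} \<in> free_colors F c' k v"
    if "w \<noteq> z" "{x, w} \<in> F \<and> c {x, w} \<in> free_colors F c k v" for v w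
  proof -
    have "c {x, w} \<noteq> a" using a that by (auto simp: free_colors_def)
    moreover have "c {x, w} \<noteq> b"
      using proper_edge_coloringD[OF F(1), of "{x, w}" "{x, z}" x] that xz bz
      by (auto simp: doubleton_eq_iff)
    moreover have "c' {x, w} = ?swap (c {x, w})" using that C(2,3) by blast
    ultimately have "c' {x, w} = c {x, w}" "?swap (c {x, w}) = c {x, w}" by auto
    then show ?thesis using that C(4,5) by (metis (full_types))
  qed
  have fan_ps: "fan F c' k x (ps @ [u])"
  proof (rule successively_mono)
    show "fan F c k x (ps @ [u])" using fan by (auto simp: successively_append_iff)
  qed (rule step, use dist in auto)
  obtain y ys where y: "ps @ [u] = y # ys" by (cases "ps @ [u]") auto
  show ?thesis
  proof (cases "u \<in> C")
    case False
    then have "b \<in> free_colors F c' k (last (ps @ [u]))" using bu C(5) by simp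
    moreover have "distinct (x # ps @ [u])" using dist by auto
    ultimately show ?thesis
      using fan_extend_coloring[OF C(1), of x y ys b] xy fan_ps bx unfolding y by simp
  next
    case True
    have "fan F c' k x qs"
    proof (rule successively_mono)
      show "fan F c k x qs" using fan by (auto simp: successively_append_iff successively_Cons)
    qed (rule step, use dist in auto)
    moreover have "{x, hd qs} \<in> F \<and> c' {x, hd qs} \<in> free_colors F c' k z" if "qs \<noteq> []"
    proof (rule step)
      show "hd qs \<noteq> z" using dist hd_in_set[OF that] by auto
    qed (use fan that in \<open>auto simp: successively_append_iff successively_Cons\<close>)
    ultimately have "fan F c' k x (z # qs)" by (auto simp: successively_Cons)
    \<comment> \<open>The swap recolors \<open>{x, z}\<close> with \<open>a\<close> and frees
      \<open>a\<close> at \<open>u\<close>, so the fan condition still holds from \<open>u\<close>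
      to \<open>z\<close>.\<close>
    moreover have "c' {x, z} = a" using C(2,3) xz bz ab by fastforce
    moreover have "a \<in> free_colors F c' k u" using C(4)[OF True, of a] bu ab by simp
    ultimately have "fan F c' k x ((ps @ [u]) @ z # qs)"
      using fan_ps xz by (simp add: successively_append_iff)
    then have "fan F c' k x (y # (ys @ z # qs))" unfolding y by simp
    moreover have l: "?l \<in> set (z # qs)" by (rule last_in_set) simp
    \<comment> \<open>In \<open>C\<close>, besides \<open>x\<close>, only one vertex can have had
      \<open>b\<close> free, and that is \<open>u\<close>; so \<open>?l\<close> lies outside and
      still has \<open>b\<close> free.\<close>
    have "?l \<noteq> x" "u \<noteq> x" "u \<noteq> ?l" using dist l by auto
    then have "?l \<notin> C" using C(6)[OF True _ _ _ bu b] by blast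
    then have "b \<in> free_colors F c' k (last (y # ys @ z # qs))" using C(5) b by simp
    moreover have "distinct (x # y # ys @ z # qs)" using dist y
      by (metis append_Cons append_Nil append_assoc)
    ultimately show ?thesis
      using fan_extend_coloring[OF C(1), of x y "ys @ z # qs" b] xy bx unfolding y by simp
  qed
qed

text \<open>Edges are added one at a time. For the new edge \<open>{x, y}\<close> a longest fan is
  taken. A color \<open>b\<close> free at its last vertex is either free at \<open>x\<close>, and
  the fan can be shifted, or sits on an edge \<open>{x, z}\<close> whose end \<open>z\<close>, by
  maximality, already belongs to the fan.\<close>

theorem vizing:
  assumes "finite E" "\<And>e. e \<in> E \<Longrightarrow> card e = 2" "\<And>v. card {e\<in>E. v \<in> e} < k"
  shows "\<exists>c. proper_edge_coloring E c k"
  using assms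
proof (induction E)
  case empty
  then show ?case by (simp add: proper_edge_coloring_def)
next
  case (insert e F)
  have deg: "card {e\<in>F. v \<in> e} < k" for v
  proof -
    have "card {e\<in>F. v \<in> e} \<le> card {e'\<in>insert e F. v \<in> e'}"
      using insert.hyps(1) by (intro card_mono) auto
    then show ?thesis using insert.prems(2)[of v] by simp
  qed
  obtain c where c: "proper_edge_coloring F c k" using insert.IH[OF _ deg] insert.prems(1) by blast
  have card2: "\<forall>e\<in>F. card e = 2" using insert.prems(1) by auto
  have free: "free_colors F c k v \<noteq> {}" for v
    by (rule free_colors_nonempty[OF insert.hyps(1) deg])
  obtain x y where e: "e = {x, y}" "x \<noteq> y" using insert.prems(1)[of e] by (auto simp: card_2_iff)
  define P where "P ys \<longleftrightarrow> distinct (x # y # ys) \<and> fan F c k x (y # ys)" for ys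
  \<comment> \<open>All fan vertices after \<open>y\<close> lie on edges of \<open>F\<close>; this
    bounds the length, so a longest fan exists.\<close>
  have "length ys < Suc (card (\<Union> F))" if "P ys" for ys
  proof -
    have "z \<in> \<Union> F" if z: "z \<in> set ys" for z
    proof -
      from z obtain i where "i < length ys" "z = ys ! i" by (auto simp: in_set_conv_nth)
      then have "{x, z} \<in> F" using \<open>P ys\<close> by (auto simp: P_def successively_conv_nth)
      then show ?thesis by auto
    qed
    moreover have "finite (\<Union> F)"
      using insert.hyps(1) card2 by (metis card.infinite finite_Union zero_neq_numeral)
    ultimately have "card (set ys) \<le> card (\<Union> F)" by (intro card_mono) auto
    then show ?thesis using \<open>P ys\<close> by (auto simp: P_def distinct_card)
  qed
  moreover have "P []" using e by (simp add: P_def)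
  ultimately obtain ys where ys: "P ys" and max: "\<And>zs. P zs \<Longrightarrow> length zs \<le> length ys"
    using ex_has_greatest_nat[of P "[]" length] by blast
  obtain a where a: "a \<in> free_colors F c k x" using free by blast
  obtain b where b: "b \<in> free_colors F c k (last (y # ys))" using free by blast
  show ?case
  proof (cases "b \<in> free_colors F c k x")
    case True
    then show ?thesis
      using fan_extend_coloring[OF c, of x y ys b] b ys insert.hyps(2) e by (auto simp: P_def)
  next
    case False
    then obtain e' where "e' \<in> F" "x \<in> e'" "c e' = b" using b by (auto simp: free_colors_def)
    moreover from this card2 obtain p q where "e' = {p, q}" "p \<noteq> q" by (metis card_2_iff)
    ultimately obtain z where z: "{x, z} \<in> F" "c {x, z} = b" "z \<noteq> x" by (auto simp: insert_commute)
    have "z \<noteq> y" using z insert.hyps(2) e by auto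
    have "z \<in> set ys"
    proof (rule ccontr)
      assume "z \<notin> set ys"
      with ys z b \<open>z \<noteq> y\<close> have "P (ys @ [z])"
        by (auto simp: P_def successively_append_iff simp flip: append_Cons)
      from max[OF this] show False by simp
    qed
    then obtain as qs where as: "ys = as @ z # qs" by (auto simp: in_set_conv_decomp)
    \<comment> \<open>\<open>u\<close> is the predecessor of \<open>z\<close> in the fan; it is
      \<open>y\<close> itself when \<open>as\<close> is empty.\<close>
    obtain ps u where ps: "y # as = ps @ [u]" by (metis list.distinct(1) rev_exhaust)
    have eq: "y # ys = ps @ u # z # qs" using as ps by simp
    have y: "hd (ps @ [u]) = y" using ps by (metis list.sel(1))
    have "\<exists>c'. proper_edge_coloring (insert {x, hd (ps @ [u])} F) c' k"
    proof (rule fan_cycle_extend_coloring[OF c card2, of x ps u z qs a b])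
      show "{x, hd (ps @ [u])} \<notin> F" using y insert.hyps(2) e by simp
      show "b \<in> free_colors F c k (last (z # qs))" using b eq by simp
    qed (use ys z a in \<open>auto simp: P_def eq simp flip: eq\<close>)
    then show ?thesis using y e by simp
  qed
qed

section \<open>Coloring the join\<close>

lemma finite_edges:
  assumes "simple_graph G"
  shows "finite (edges G)"
  using assms unfolding simple_graph_def by (auto intro: finite_subset[of _ "Pow (verts G)"])

lemma simple_graph_edgeD:
  assumes "simple_graph G" "{u, v} \<in> edges G"
  shows "u \<in> verts G" "v \<in> verts G" "u \<noteq> v"
proof -
  have "{u, v} \<subseteq> verts G" "card {u, v} = 2" using assms by (auto simp: simple_graph_def)
  then show "u \<in> verts G" "v \<in> verts G" "u \<noteq> v" by (auto simp: card_2_iff doubleton_eq_iff)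
qed

lemma degree_le_max_degree:
  assumes "simple_graph G"
  shows "degree G v \<le> max_degree G"
proof (cases "v \<in> verts G")
  case True
  then show ?thesis using assms unfolding max_degree_def simple_graph_def by (intro Max_ge) auto
next
  case False
  then have "{e \<in> edges G. v \<in> e} = {}" using assms by (auto simp: simple_graph_def)
  then show ?thesis by (simp only: degree_def card.empty le0)
qed

text \<open>The \<open>LEAST\<close> in the definition is attained as soon as some coloring exists;
  numbering all vertices and edges injectively gives one.\<close>

lemma total_chromatic_number_coloring:
  assumes G: "simple_graph G"
  obtains f :: "'a + 'a set \<Rightarrow> nat" where "proper_total_coloring G f"
    "f ` (verts G <+> edges G) \<subseteq> {..<total_chromatic_number G}"
proof -
  have "finite (verts G <+> edges G)" using G finite_edges[OF G] by (simp add: simple_graph_def)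
  then obtain f :: "'a + 'a set \<Rightarrow> nat" and m where f: "f ` (verts G <+> edges G) = {i. i < m}"
    "inj_on f (verts G <+> edges G)" by (elim finite_imp_inj_to_nat_seg[THEN exE]) blast
  have "f p \<noteq> f q" if "p \<in> verts G <+> edges G" "q \<in> verts G <+> edges G" "p \<noteq> q" for p q
    using f(2) that by (auto dest: inj_onD)
  moreover have "v \<in> verts G" if "e \<in> edges G" "v \<in> e" for e v
    using G that by (auto simp: simple_graph_def)
  ultimately have "proper_total_coloring G f"
    unfolding proper_total_coloring_def
    using simple_graph_edgeD[OF G] by (metis InlI InrI sum.inject sum.distinct(1))
  then have "\<exists>k (f :: 'a + 'a set \<Rightarrow> nat).
      proper_total_coloring G f \<and> f ` (verts G <+> edges G) \<subseteq> {..<k}"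
    using f(1) by (intro exI[of _ m] exI[of _ f]) auto
  from LeastI_ex[OF this] show thesis
    using that unfolding total_chromatic_number_def by blast
qed

text \<open>For summands below \<open>N\<close> the reduction is at most one subtraction, which
  gives injectivity; equal cardinalities give the rest.\<close>

lemma bij_betw_rotate:
  fixes N :: nat
  assumes "i < N"
  shows "bij_betw (\<lambda>j. D + (i + j) mod N) {..<N} {D..<D + N}"
proof -
  have mod: "(i + j) mod N = (if i + j < N then i + j else i + j - N)" if "j < N" for j
    using assms that by (simp add: mod_if)
  have "inj_on (\<lambda>j. D + (i + j) mod N) {..<N}"
    by (rule inj_onI) (auto simp: mod split: if_splits)
  moreover have "(\<lambda>j. D + (i + j) mod N) ` {..<N} \<subseteq> {D..<D + N}" using assms by auto
  ultimately show ?thesis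
    unfolding bij_betw_def by (simp add: card_image card_subset_eq)
qed

lemma edge_color_in_color_set: "{u, w} \<in> edges G \<Longrightarrow> f (Inr {u, w}) \<in> color_set G f u"
  by (auto simp: color_set_def)

section \<open>Edges and maximum degree of a join\<close>

lemma join_edge_cases:
  assumes "e \<in> edges (join G H)"
  obtains d where "d \<in> edges G" "e = Inl ` d"
    | d where "d \<in> edges H" "e = Inr ` d"
    | u v where "u \<in> verts G" "v \<in> verts H" "e = {Inl u, Inr v}"
  using assms by (auto simp: join_def)

text \<open>The empty set is excluded because its images under \<open>Inl\<close> and
  \<open>Inr\<close> coincide.\<close>

lemma Inl_image_edge_join:
  assumes "d \<noteq> {}"
  shows "Inl ` d \<in> edges (join G H) \<longleftrightarrow> d \<in> edges G"
proof
  assume "Inl ` d \<in> edges (join G H)"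
  then show "d \<in> edges G" by (rule join_edge_cases) (use assms in \<open>auto simp: inj_image_eq_iff\<close>)
qed (simp add: join_def)

lemma Inr_image_edge_join:
  assumes "d \<noteq> {}"
  shows "Inr ` d \<in> edges (join G H) \<longleftrightarrow> d \<in> edges H"
proof
  assume "Inr ` d \<in> edges (join G H)"
  then show "d \<in> edges H" by (rule join_edge_cases) (use assms in \<open>auto simp: inj_image_eq_iff\<close>)
qed (simp add: join_def)

lemma join_edges [simp]:
  "{Inl u, Inl u'} \<in> edges (join G H) \<longleftrightarrow> {u, u'} \<in> edges G"
  "{Inr v, Inr v'} \<in> edges (join G H) \<longleftrightarrow> {v, v'} \<in> edges H"
  "{Inl u, Inr v} \<in> edges (join G H) \<longleftrightarrow> u \<in> verts G \<and> v \<in> verts H"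
  "{Inr v, Inl u} \<in> edges (join G H) \<longleftrightarrow> u \<in> verts G \<and> v \<in> verts H"
proof -
  show "{Inl u, Inl u'} \<in> edges (join G H) \<longleftrightarrow> {u, u'} \<in> edges G"
    using Inl_image_edge_join[of "{u, u'}"] by simp
  show "{Inr v, Inr v'} \<in> edges (join G H) \<longleftrightarrow> {v, v'} \<in> edges H"
    using Inr_image_edge_join[of "{v, v'}"] by simp
  show "{Inl u, Inr v} \<in> edges (join G H) \<longleftrightarrow> u \<in> verts G \<and> v \<in> verts H"
    by (auto simp: join_def doubleton_eq_iff)
  then show "{Inr v, Inl u} \<in> edges (join G H) \<longleftrightarrow> u \<in> verts G \<and> v \<in> verts H"
    by (simp add: insert_commute)
qed

text \<open>In the join, a vertex \<open>u\<close> of maximum degree in \<open>G\<close> gains every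
  vertex of \<open>H\<close> as a neighbor. If \<open>G\<close> has no vertices, equal orders make
  the left side zero.\<close>

lemma max_degree_join:
  assumes G: "simple_graph G" and H: "simple_graph H" and card: "card (verts G) = card (verts H)"
  shows "max_degree G + card (verts H) \<le> max_degree (join G H)"
proof (cases "verts G = {}")
  case True
  then show ?thesis using card by (simp add: max_degree_def)
next
  case False
  have fin: "finite (verts G)" "finite (verts H)" using G H by (auto simp: simple_graph_def)
  have "max_degree G \<in> insert 0 (degree G ` verts G)"
    unfolding max_degree_def using fin by (intro Max_in) auto
  then obtain u where u: "u \<in> verts G" "max_degree G \<le> degree G u"
    using False by (metis all_not_in_conv image_iff insertE le0 order_refl)
  let ?A = "(image Inl :: 'a set \<Rightarrow> ('a + 'b) set) ` {e \<in> edges G. u \<in> e}"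
    and ?B = "(\<lambda>v. {Inl u, Inr v} :: ('a + 'b) set) ` verts H"
  have "inj_on (image Inl :: 'a set \<Rightarrow> ('a + 'b) set) X" for X
    by (rule inj_onI) (simp add: inj_image_eq_iff)
  moreover have "inj_on (\<lambda>v. {Inl u, Inr v} :: ('a + 'b) set) (verts H)"
    by (rule inj_onI) (auto simp: doubleton_eq_iff)
  moreover have "?A \<inter> ?B = {}" by blast
  moreover have "finite ?A" "finite ?B" using finite_edges[OF G] fin by auto
  ultimately have "card (?A \<union> ?B) = degree G u + card (verts H)"
    by (simp add: card_Un_disjoint card_image degree_def)
  moreover have "finite (edges (join G H))"
  proof -
    have "edges (join G H) \<subseteq> Pow (verts G <+> verts H)"
      using G H by (fastforce simp: join_def simple_graph_def)
    then show ?thesis using fin by (meson finite_Plus finite_Pow_iff finite_subset)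
  qed
  then have "card (?A \<union> ?B) \<le> degree (join G H) (Inl u)"
    unfolding degree_def using u(1) by (intro card_mono) (auto simp: join_def)
  moreover have "degree (join G H) (Inl u) \<le> max_degree (join G H)"
    unfolding max_degree_def using u(1) fin by (intro Max_ge) (auto simp: join_def)
  ultimately show ?thesis using u(2) by simp
qed

theorem theorem4p8:
  fixes G1 :: "'a graph" and G2 :: "'b graph" and n :: nat
  assumes "simple_graph G1" and "simple_graph G2"
    and "card (verts G1) = n" and "card (verts G2) = n"
    and "type_1 G1"
    and "max_degree G2 \<le> max_degree G1"
  shows "satisfies_avd_tcc (join G1 G2)"
proof -
  define D N where "D = max_degree G1 + 1" and "N = n + 2"
  let ?J = "join G1 G2"
  have fin: "finite (verts G1)" "finite (verts G2)" using assms(1,2) by (auto simp: simple_graph_def)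
  have "total_chromatic_number G1 = D" using assms(5) by (simp add: type_1_def D_def)
  then obtain f1 :: "'a + 'a set \<Rightarrow> nat" where f1: "proper_total_coloring G1 f1"
    and f1_less: "f1 ` (verts G1 <+> edges G1) \<subseteq> {..<D}"
    using total_chromatic_number_coloring[OF assms(1)] by metis
  have f1_edges: "f1 (Inr d) \<noteq> f1 (Inr d')"
    if "d \<in> edges G1" "d' \<in> edges G1" "u \<in> d" "u \<in> d'" "d \<noteq> d'" for d d' u
    using f1 that unfolding proper_total_coloring_def by blast
  \<comment> \<open>Here \<Delta>(G2) \<le> \<Delta>(G1) enters: \<open>D\<close> exceeds every
    degree of \<open>G2\<close>, as Vizing's theorem asks.\<close>
  have "card {e \<in> edges G2. v \<in> e} < D" for v
    using degree_le_max_degree[OF assms(2), of v] assms(6) by (simp add: degree_def D_def)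
  then obtain c where c: "proper_edge_coloring (edges G2) c D"
    using vizing[OF finite_edges[OF assms(2)]] assms(2) unfolding simple_graph_def by blast
  obtain g1 where "bij_betw g1 (verts G1) {0..<n}"
    using ex_bij_betw_finite_nat[OF fin(1)] assms(3) by blast
  then have g1: "inj_on g1 (verts G1)" "g1 ` verts G1 = {..<n}"
    by (auto simp: bij_betw_def atLeast0LessThan)
  obtain g2 where "bij_betw g2 (verts G2) {0..<n}"
    using ex_bij_betw_finite_nat[OF fin(2)] assms(4) by blast
  then have g2: "inj_on g2 (verts G2)" "g2 ` verts G2 = {..<n}"
    by (auto simp: bij_betw_def atLeast0LessThan)
  have g1_less: "g1 u < n" if "u \<in> verts G1" for u using g1(2) that by auto
  have g2_less: "g2 v < n" if "v \<in> verts G2" for v using g2(2) that by auto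

  \<comment> \<open>The addition table modulo \<open>N\<close>, a symmetric Latin square, with
    entries moved past the \<open>D\<close> old colors. The indices \<open>n\<close> and
    \<open>n + 1\<close> belong to no vertex.\<close>
  define r where "r i j = D + (i + j) mod N" for i j
  have r_bij: "bij_betw (r i) {..<N} {D..<D + N}" if "i < N" for i
    using bij_betw_rotate[OF that] unfolding r_def .
  have r_comm: "r i j = r j i" for i j by (simp add: r_def add.commute)
  have r_eq: "r i j = r i j' \<longleftrightarrow> j = j'" if "i < N" "j < N" "j' < N" for i j j'
    using bij_betw_imp_inj_on[OF r_bij[OF that(1)]] that by (auto dest: inj_onD)
  have r_bounds: "D \<le> r i j" "r i j < D + N" for i j by (auto simp: r_def N_def)

  \<comment> \<open>The cases are the edges inside \<open>G1\<close>, those inside \<open>G2\<close>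
    and the mixed ones, where \<open>THE\<close> picks the unique end on each side. The empty set
    falls under the first case, hence the vertex \<open>v\<close> in \<open>fe_Inr\<close>.\<close>
  define fe :: "('a + 'b) set \<Rightarrow> nat" where "fe e =
    (if e \<subseteq> range Inl then f1 (Inr (Inl -` e)) else if e \<subseteq> range Inr then c (Inr -` e)
     else r (g1 (THE u. Inl u \<in> e)) (g2 (THE v. Inr v \<in> e)))" for e
  \<comment> \<open>A vertex of \<open>G2\<close> is colored like a mixed edge to an extra vertex of
    \<open>G1\<close> numbered \<open>n\<close>.\<close>
  define f where "f = case_sum (case_sum (\<lambda>u. f1 (Inl u)) (\<lambda>v. r n (g2 v))) fe"
  have f1_vert_less: "f1 (Inl u) < D" if "u \<in> verts G1" for u using f1_less that by auto
  have fe_Inl: "fe (Inl ` d) = f1 (Inr d)" for d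
    by (simp add: fe_def inj_vimage_image_eq image_mono)
  have fe_Inr: "fe (Inr ` d) = c d" if "v \<in> d" for d v
  proof -
    have "\<not> Inr ` d \<subseteq> (range Inl :: ('a + 'b) set)" using that by auto
    then show ?thesis by (simp add: fe_def inj_vimage_image_eq image_mono)
  qed
  have fe_mixed: "fe {Inl u, Inr v} = r (g1 u) (g2 v)" for u v
    by (auto simp: fe_def)
  have f_simps: "f (Inl (Inl u)) = f1 (Inl u)" "f (Inl (Inr v)) = r n (g2 v)" "f (Inr e) = fe e"
    for u v e by (simp_all add: f_def)

  \<comment> \<open>An edge at a vertex has either an old color below \<open>D\<close> or an entry
    of that vertex's own row of \<open>r\<close>, so a clash is possible only within one kind. In
    \<open>edge_Inr\<close> the symmetry of \<open>r\<close> puts the index of \<open>v\<close>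
    first for this purpose.\<close>
  have edge_Inl: "u \<in> verts G1 \<and> ((\<exists>d\<in>edges G1. u \<in> d \<and> e = Inl ` d \<and> fe e = f1 (Inr d) \<and> fe e < D) \<or>
      (\<exists>v\<in>verts G2. e = {Inl u, Inr v} \<and> fe e = r (g1 u) (g2 v)))"
    if e: "e \<in> edges ?J" "Inl u \<in> e" for e u
    using e(1)
  proof (cases rule: join_edge_cases)
    case (1 d)
    then have "u \<in> d" "f1 (Inr d) < D" using e(2) f1_less by auto
    moreover have "u \<in> verts G1" using \<open>u \<in> d\<close> 1(1) assms(1) by (auto simp: simple_graph_def)
    ultimately show ?thesis using 1 fe_Inl by metis
  qed (use e(2) fe_mixed in auto)
  have edge_Inr: "v \<in> verts G2 \<and> ((\<exists>d\<in>edges G2. v \<in> d \<and> e = Inr ` d \<and> fe e = c d \<and> fe e < D) \<or>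
      (\<exists>u\<in>verts G1. e = {Inl u, Inr v} \<and> fe e = r (g2 v) (g1 u)))"
    if e: "e \<in> edges ?J" "Inr v \<in> e" for e v
    using e(1)
  proof (cases rule: join_edge_cases)
    case (2 d)
    then have "v \<in> d" "c d < D" using e(2) c by (auto simp: proper_edge_coloring_def)
    moreover have "v \<in> verts G2" using \<open>v \<in> d\<close> 2(1) assms(2) by (auto simp: simple_graph_def)
    moreover have "fe e = c d" using 2(2) \<open>v \<in> d\<close> fe_Inr by blast
    ultimately show ?thesis using 2 by metis
  qed (use e(2) fe_mixed r_comm in auto)

  \<comment> \<open>Properness of the coloring\<close>
  have proper: "proper_total_coloring ?J f"
    unfolding proper_total_coloring_def
  proof (intro conjI allI ballI impI)
    fix p q assume pq: "{p, q} \<in> edges ?J"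
    have "f1 (Inl u) \<noteq> r n (g2 v)" if "u \<in> verts G1" for u v
      using f1_vert_less[OF that] r_bounds(1)[of n "g2 v"] by simp
    moreover have "f1 (Inl u) \<noteq> f1 (Inl u')" if "{u, u'} \<in> edges G1" for u u'
      using f1 that by (auto simp: proper_total_coloring_def)
    moreover have "r n (g2 v) \<noteq> r n (g2 v')" if e: "{v, v'} \<in> edges G2" for v v'
    proof -
      note v = simple_graph_edgeD[OF assms(2) e]
      then have "g2 v \<noteq> g2 v'" using g2(1) by (auto dest: inj_onD)
      then show ?thesis using r_eq g2_less v(1,2) by (simp add: N_def less_imp_le less_SucI)
    qed
    ultimately show "f (Inl p) \<noteq> f (Inl q)"
      using pq by (cases p; cases q) (auto simp: f_simps dest: not_sym)
  next
    fix e e' assume e: "e \<in> edges ?J" "e' \<in> edges ?J" "e \<noteq> e' \<and> e \<inter> e' \<noteq> {}"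
    then obtain p where p: "p \<in> e" "p \<in> e'" by blast
    show "f (Inr e) \<noteq> f (Inr e')"
    proof (cases p)
      case (Inl u)
      have "f1 (Inr d) \<noteq> f1 (Inr d')" if "d \<in> edges G1" "d' \<in> edges G1" "u \<in> d" "u \<in> d'" "d \<noteq> d'" for d d'
        using f1_edges that by blast
      moreover have "r (g1 u) (g2 v) \<noteq> r (g1 u) (g2 v')"
        if "u \<in> verts G1" "v \<in> verts G2" "v' \<in> verts G2" "v \<noteq> v'" for v v'
        using r_eq[of "g1 u" "g2 v" "g2 v'"] g1_less g2_less that inj_onD[OF g2(1)]
        by (fastforce simp: N_def)
      ultimately show ?thesis
        using edge_Inl[OF e(1), of u] edge_Inl[OF e(2), of u] p e(3) Inl r_bounds(1)
        unfolding f_simps by (metis not_less)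
    next
      case (Inr v)
      have "c d \<noteq> c d'" if "d \<in> edges G2" "d' \<in> edges G2" "v \<in> d" "v \<in> d'" "d \<noteq> d'" for d d'
        using proper_edge_coloringD[OF c] that by blast
      moreover have "r (g2 v) (g1 u) \<noteq> r (g2 v) (g1 u')"
        if "v \<in> verts G2" "u \<in> verts G1" "u' \<in> verts G1" "u \<noteq> u'" for u u'
        using r_eq[of "g2 v" "g1 u" "g1 u'"] g1_less g2_less that inj_onD[OF g1(1)]
        by (fastforce simp: N_def)
      ultimately show ?thesis
        using edge_Inr[OF e(1), of v] edge_Inr[OF e(2), of v] p e(3) Inr r_bounds(1)
        unfolding f_simps by (metis not_less)
    qed
  next
    fix e p assume e: "e \<in> edges ?J" "p \<in> e"
    show "f (Inl p) \<noteq> f (Inr e)"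
    proof (cases p)
      case (Inl u)
      then have "Inl u \<in> e" using e by simp
      note * = edge_Inl[OF e(1) this]
      have "f1 (Inl u) \<noteq> f1 (Inr d)" if "d \<in> edges G1" "u \<in> d" for d
        using f1 that unfolding proper_total_coloring_def by blast
      moreover have "f1 (Inl u) \<noteq> r (g1 u) (g2 v)" for v
        using f1_vert_less[of u] * r_bounds(1)[of "g1 u" "g2 v"] by auto
      ultimately show ?thesis using * Inl by (metis f_simps(1,3))
    next
      case (Inr v)
      then have "Inr v \<in> e" using e by simp
      note * = edge_Inr[OF e(1) this]
      \<comment> \<open>Column \<open>n\<close> of row \<open>g2 v\<close> is taken by no mixed
        edge, since \<open>g1 u < n\<close>.\<close>
      have "r n (g2 v) \<noteq> r (g2 v) (g1 u)" if "u \<in> verts G1" for u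
        using r_eq[of "g2 v" n "g1 u"] g1_less[OF that] g2_less[of v] * r_comm[of n "g2 v"]
        by (simp add: N_def)
      moreover have "\<not> r n (g2 v) < D" using r_bounds(1)[of n "g2 v"] by simp
      ultimately show ?thesis using * Inr by (metis f_simps(2,3))
    qed
  qed

  \<comment> \<open>Color sets of the vertices\<close>
  have upper_Inl: "color_set ?J f (Inl u) \<inter> {D..<D + N} = r (g1 u) ` {..<n}"
    if u: "u \<in> verts G1" for u
  proof
    show "color_set ?J f (Inl u) \<inter> {D..<D + N} \<subseteq> r (g1 u) ` {..<n}"
    proof
      fix x assume "x \<in> color_set ?J f (Inl u) \<inter> {D..<D + N}"
      then obtain w where w: "x = fe {Inl u, w}" "{Inl u, w} \<in> edges ?J" "\<not> x < D"
        using f1_vert_less[OF u] by (auto simp: color_set_def f_simps)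
      then show "x \<in> r (g1 u) ` {..<n}"
        using edge_Inl[OF w(2), of u] g2_less by auto
    qed
    have "r (g1 u) (g2 v) \<in> color_set ?J f (Inl u)" if "v \<in> verts G2" for v
    proof -
      have "f (Inr {Inl u, Inr v}) = r (g1 u) (g2 v)" by (simp add: f_simps fe_mixed)
      moreover have "{Inl u, Inr v} \<in> edges ?J" using that u by simp
      ultimately show ?thesis using edge_color_in_color_set by metis
    qed
    then show "r (g1 u) ` {..<n} \<subseteq> color_set ?J f (Inl u) \<inter> {D..<D + N}"
      using r_bounds by (auto simp flip: g2(2))
  qed
  \<comment> \<open>One column more than in \<open>upper_Inl\<close>: column \<open>n\<close> holds
    the color of \<open>v\<close> itself, whereas a vertex of \<open>G1\<close> has an old
    color.\<close>
  have upper_Inr: "color_set ?J f (Inr v) \<inter> {D..<D + N} = r (g2 v) ` {..<n + 1}"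
    if v: "v \<in> verts G2" for v
  proof
    show "color_set ?J f (Inr v) \<inter> {D..<D + N} \<subseteq> r (g2 v) ` {..<n + 1}"
    proof
      fix x assume "x \<in> color_set ?J f (Inr v) \<inter> {D..<D + N}"
      then consider "x = r (g2 v) n"
        | w where "x = fe {Inr v, w}" "{Inr v, w} \<in> edges ?J" "\<not> x < D"
        by (auto simp: color_set_def f_simps r_comm)
      then show "x \<in> r (g2 v) ` {..<n + 1}"
      proof cases
        case (2 w)
        then show ?thesis using edge_Inr[OF 2(2), of v] g1_less by (auto intro!: imageI less_SucI)
      qed auto
    qed
    have "r (g2 v) (g1 u) \<in> color_set ?J f (Inr v)" if "u \<in> verts G1" for u
    proof -
      have "f (Inr {Inr v, Inl u}) = r (g2 v) (g1 u)"
        using fe_mixed[of u v] r_comm[of "g1 u"] by (simp add: f_simps insert_commute)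
      moreover have "{Inr v, Inl u} \<in> edges ?J" using that v by simp
      ultimately show ?thesis using edge_color_in_color_set by metis
    qed
    moreover have "r (g2 v) n \<in> color_set ?J f (Inr v)"
      by (simp add: color_set_def f_simps r_comm[of "g2 v" n])
    moreover have "{..<n + 1} = insert n (g1 ` verts G1)" using g1(2) by auto
    ultimately show "r (g2 v) ` {..<n + 1} \<subseteq> color_set ?J f (Inr v) \<inter> {D..<D + N}"
      using r_bounds by auto
  qed
  have missing_Inl: "{D..<D + N} - color_set ?J f (Inl u) = {r (g1 u) n, r (g1 u) (n + 1)}"
    if "u \<in> verts G1" for u
  proof -
    have "g1 u < N" using g1_less[OF that] by (simp add: N_def)
    note bij = r_bij[OF this]
    have "{D..<D + N} - color_set ?J f (Inl u) = r (g1 u) ` {..<N} - r (g1 u) ` {..<n}"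
      using upper_Inl[OF that] bij by (auto simp: bij_betw_def)
    also have "\<dots> = r (g1 u) ` ({..<N} - {..<n})"
      using bij by (intro inj_on_image_set_diff[symmetric]) (auto simp: bij_betw_def N_def)
    also have "{..<N} - {..<n} = {n, n + 1}" by (auto simp: N_def)
    finally show ?thesis by simp
  qed
  have missing_Inr: "{D..<D + N} - color_set ?J f (Inr v) = {r (g2 v) (n + 1)}"
    if "v \<in> verts G2" for v
  proof -
    have "g2 v < N" using g2_less[OF that] by (simp add: N_def)
    note bij = r_bij[OF this]
    have "{D..<D + N} - color_set ?J f (Inr v) = r (g2 v) ` {..<N} - r (g2 v) ` {..<n + 1}"
      using upper_Inr[OF that] bij by (auto simp: bij_betw_def)
    also have "\<dots> = r (g2 v) ` ({..<N} - {..<n + 1})"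
      using bij by (intro inj_on_image_set_diff[symmetric]) (auto simp: bij_betw_def N_def)
    also have "{..<N} - {..<n + 1} = {n + 1}" by (auto simp: N_def)
    finally show ?thesis by simp
  qed
  have Inl_Inr: "color_set ?J f (Inl u) \<noteq> color_set ?J f (Inr v)"
    if "u \<in> verts G1" "v \<in> verts G2" for u v
  proof
    assume "color_set ?J f (Inl u) = color_set ?J f (Inr v)"
    \<comment> \<open>The two colors missing at \<open>u\<close> would both be the single color
      missing at \<open>v\<close>.\<close>
    then have "r (g1 u) n = r (g1 u) (n + 1)"
      using missing_Inl[OF that(1)] missing_Inr[OF that(2)] by (metis insertCI singletonD)
    then show False using r_eq[of "g1 u" n "n + 1"] g1_less[OF that(1)] by (simp add: N_def)
  qed
  have Inl_Inl: "color_set ?J f (Inl u) \<noteq> color_set ?J f (Inl u')"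
    if u: "u \<in> verts G1" "u' \<in> verts G1" "u \<noteq> u'" for u u'
  proof
    assume "color_set ?J f (Inl u) = color_set ?J f (Inl u')"
    then have "{r (g1 u) n, r (g1 u) (n + 1)} = {r (g1 u') n, r (g1 u') (n + 1)}"
      using missing_Inl u(1,2) by metis
    moreover have "g1 u < n" "g1 u' < n" "g1 u \<noteq> g1 u'"
      using g1_less u inj_onD[OF g1(1)] by auto
    \<comment> \<open>Matching the pairs in order contradicts \<open>g1 u \<noteq> g1 u'\<close>;
      matching them crosswise gives \<open>2 = 0\<close> modulo \<open>N\<close>, impossible as
      \<open>N > 2\<close>.\<close>
    ultimately show False
      by (auto simp: doubleton_eq_iff r_def N_def mod_if split: if_splits)
  qed
  have Inr_Inr: "color_set ?J f (Inr v) \<noteq> color_set ?J f (Inr v')"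
    if v: "v \<in> verts G2" "v' \<in> verts G2" "v \<noteq> v'" for v v'
  proof
    assume "color_set ?J f (Inr v) = color_set ?J f (Inr v')"
    \<comment> \<open>By the symmetry of \<open>r\<close> the missing colors are entries of row
      \<open>n + 1\<close>, which has no repetitions.\<close>
    then have "r (n + 1) (g2 v) = r (n + 1) (g2 v')"
      using missing_Inr v(1,2) r_comm by (metis singleton_inject)
    then show False
      using r_eq[of "n + 1" "g2 v" "g2 v'"] g2_less v inj_onD[OF g2(1)] by (fastforce simp: N_def)
  qed
  have "color_set ?J f p \<noteq> color_set ?J f q" if e: "{p, q} \<in> edges ?J" for p q
  proof (cases p)
    case (Inl u)
    then show ?thesis
      using e Inl_Inr Inl_Inl simple_graph_edgeD[OF assms(1)] by (cases q) auto
  next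
    case (Inr v)
    then show ?thesis
      using e Inl_Inr[THEN not_sym] Inr_Inr simple_graph_edgeD[OF assms(2)] by (cases q) auto
  qed
  with proper have "avd_total_coloring ?J f" by (simp add: avd_total_coloring_def)

  \<comment> \<open>Number of colors\<close>
  moreover have "f ` (verts ?J <+> edges ?J) \<subseteq> {..<D + N}"
  proof -
    have "f (Inl p) < D + N" if "p \<in> verts ?J" for p
      using that f1_vert_less r_bounds(2) by (cases p) (auto simp: join_def f_simps intro: trans_less_add1)
    moreover have "f (Inr e) < D + N" if e: "e \<in> edges ?J" for e
    proof -
      have "e \<noteq> {}" using e assms(1,2) by (auto simp: join_def simple_graph_def)
      then obtain p where "p \<in> e" by blast
      then show ?thesis
        using edge_Inl[OF e] edge_Inr[OF e] r_bounds(2)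
        by (cases p) (auto simp: f_simps, (metis trans_less_add1)+)
    qed
    ultimately show ?thesis by auto
  qed
  ultimately have "avd_total_chromatic_number ?J \<le> D + N"
    unfolding avd_total_chromatic_number_def by (intro Least_le) blast
  \<comment> \<open>\<open>D + N\<close> is \<open>max_degree G1 + n + 3\<close>, and the maximum
    degree of the join is at least \<open>max_degree G1 + n\<close>.\<close>
  also have "\<dots> \<le> max_degree ?J + 3"
    using max_degree_join[OF assms(1,2)] assms(3,4) by (simp add: D_def N_def)
  finally show ?thesis by (simp add: satisfies_avd_tcc_def)
qed

end
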